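(* Let $(X,d)$ be a compact metric space and let $T:X\to 2^X$ be upper semi-continuous, open and expanding. Let $\alpha\in(0,1]$. For every $\alpha$-Hölder function $f:gr(T)\to\mathbb{R}$ there exists an $\alpha$-Hölder function $v:X\to\mathbb{R}$ such that $$f+v\circ\pi-v\circ\pi'\le\beta\bigl(gr(T),\hat{T},f\bigr),$$ that is, $f(x,y)+v(x)-v(y)\le\beta\bigl(gr(T),\hat{T},f\bigr)$ for all $(x,y)\in gr(T)$.
   Context: $2^X$ is the set of all subsets of $X$ (the value $\emptyset$ is allowed). $T:X\to2^X$ is upper semi-continuous if for every $x\in X$ and every open $V\supseteq T(x)$ there is an open $U\ni x$ with $T(u)\subseteq V$ for all $u\in U$. It is open if $T(A):=\bigcup_{x\in A}T(x)$ is open in $X$ for every open $A\subseteq X$. It is expanding (with respect to $d$) if there exist $\lambda>1$ and $\eta>0$ such that for all $x,y\in X$ with $d(x,y)\le\eta$ one has $\inf\{d(x',y'):x'\in T(x),\,y'\in T(y)\}\ge\lambda d(x,y)$ (with $\inf\emptyset=+\infty$). The graph is $gr(T)=\{(x,x')\in X^2:x'\in T(x)\}$, with metric $\hat{d}((x,y),(x',y'))=\max(d(x,x'),d(y,y'))$, and $\pi(x,y)=x$, $\pi'(x,y)=y$ are the coordinate projections. The graph system is the upper semi-continuous map $\hat{T}:gr(T)\to2^{gr(T)}$, $\hat{T}(x,y)=\{(y,z):z\in T(y)\}$. For a compact metrizable space $Y$, an upper semi-continuous $S:Y\to2^Y$ and a continuous $g:Y\to\mathbb{R}$, a Borel probability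 measure $\mu$ on $Y$ is $S$-invariant if $\mu(A)\le\mu(S^{-1}(A))$ for all Borel $A\subseteq Y$, where $S^{-1}(A)=\{y\in Y:S(y)\cap A\neq\emptyset\}$ (a universally measurable set, measured via the completion of $\mu$). The maximum ergodic average is $\beta(Y,S,g)=\sup\{\int g\,d\mu:\mu\text{ is }S\text{-invariant}\}$, with the convention $\sup\emptyset=-\infty$. A real function $g$ on a metric space $(Z,d_Z)$ is $\alpha$-Hölder if there is $K>0$ with $|g(z)-g(z')|\le K d_Z(z,z')^\alpha$ for all $z,z'\in Z$.
   Formalization: Two assumptions are made explicit: gr(T) is compact (needed for β to be defined), and, if gr(T) is nonempty, it carries a T̂-invariant probability measure (otherwise β = −∞ and the inequality fails, e.g. X={0,1}, T(0)={1}, T(1)=∅). *)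

theory Defs
  imports "HOL-Probability.Probability"
begin

text \<open>Set-valued self-maps of a space are modelled by a carrier \<open>X\<close> and a function
  \<open>T\<close> with \<open>T x \<subseteq> X\<close> for \<open>x \<in> X\<close>; all topological notions are relative to \<open>X\<close>.
  The value \<open>T x = {}\<close> is allowed.\<close>

definition set_valued_map_on :: "'a set \<Rightarrow> ('a \<Rightarrow> 'a set) \<Rightarrow> bool" where
  "set_valued_map_on X T \<longleftrightarrow> (\<forall>x\<in>X. T x \<subseteq> X)"

definition upper_semicontinuous_on :: "'a::topological_space set \<Rightarrow> ('a \<Rightarrow> 'a set) \<Rightarrow> bool" where
  "upper_semicontinuous_on X T \<longleftrightarrow>
     (\<forall>x\<in>X. \<forall>V. openin (top_of_set X) V \<and> T x \<subseteq> V \<longrightarrow>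
        (\<exists>U. openin (top_of_set X) U \<and> x \<in> U \<and> (\<forall>u\<in>U. T u \<subseteq> V)))"

definition open_set_valued_on :: "'a::topological_space set \<Rightarrow> ('a \<Rightarrow> 'a set) \<Rightarrow> bool" where
  "open_set_valued_on X T \<longleftrightarrow>
     (\<forall>A. openin (top_of_set X) A \<longrightarrow> openin (top_of_set X) (\<Union>x\<in>A. T x))"

text \<open>The infimum is taken in \<^typ>\<open>ereal\<close>, so that the infimum of the empty set is \<open>\<infinity>\<close>.\<close>

definition expanding_on :: "'a::metric_space set \<Rightarrow> ('a \<Rightarrow> 'a set) \<Rightarrow> bool" where
  "expanding_on X T \<longleftrightarrow>
     (\<exists>L>1. \<exists>\<eta>>0. \<forall>x\<in>X. \<forall>y\<in>X. dist x y \<le> \<eta> \<longrightarrow>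
        ereal (L * dist x y) \<le> Inf {ereal (dist x' y') | x' y'. x' \<in> T x \<and> y' \<in> T y})"

definition gr :: "'a set \<Rightarrow> ('a \<Rightarrow> 'a set) \<Rightarrow> ('a \<times> 'a) set" where
  "gr X T = {(x, x'). x \<in> X \<and> x' \<in> T x}"

text \<open>The library metric on products is the Euclidean one; the graph carries the maximum metric
  (which induces the same topology).\<close>

definition max_dist :: "'a::metric_space \<times> 'a \<Rightarrow> 'a \<times> 'a \<Rightarrow> real" where
  "max_dist p q = max (dist (fst p) (fst q)) (dist (snd p) (snd q))"

definition graph_system :: "('a \<Rightarrow> 'a set) \<Rightarrow> 'a \<times> 'a \<Rightarrow> ('a \<times> 'a) set" where
  "graph_system T = (\<lambda>(x, y). {(y, z) | z. z \<in> T y})"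

definition holder_on :: "'z set \<Rightarrow> ('z \<Rightarrow> 'z \<Rightarrow> real) \<Rightarrow> real \<Rightarrow> ('z \<Rightarrow> real) \<Rightarrow> bool" where
  "holder_on Z d \<alpha> g \<longleftrightarrow> (\<exists>K>0. \<forall>z\<in>Z. \<forall>z'\<in>Z. \<bar>g z - g z'\<bar> \<le> K * d z z' powr \<alpha>)"

definition set_preimage :: "'y set \<Rightarrow> ('y \<Rightarrow> 'y set) \<Rightarrow> 'y set \<Rightarrow> 'y set" where
  "set_preimage Y S A = {y \<in> Y. S y \<inter> A \<noteq> {}}"

text \<open>The preimage of a Borel set need not be Borel, so it is measured in the completion.\<close>

definition invariant_measure ::
    "'y::topological_space set \<Rightarrow> ('y \<Rightarrow> 'y set) \<Rightarrow> 'y measure \<Rightarrow> bool" where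
  "invariant_measure Y S \<mu> \<longleftrightarrow>
     prob_space \<mu> \<and> sets \<mu> = sets (restrict_space borel Y) \<and>
     (\<forall>A\<in>sets \<mu>. emeasure \<mu> A \<le> emeasure (completion \<mu>) (set_preimage Y S A))"

text \<open>Valued in \<^typ>\<open>ereal\<close>; the value is \<open>-\<infinity>\<close> if there is no invariant measure.\<close>

definition max_ergodic_average ::
    "'y::topological_space set \<Rightarrow> ('y \<Rightarrow> 'y set) \<Rightarrow> ('y \<Rightarrow> real) \<Rightarrow> ereal" where
  "max_ergodic_average Y S g =
     (SUP \<mu>\<in>{\<mu>. invariant_measure Y S \<mu>}. ereal (\<integral>y. g y \<partial>\<mu>))"

end

theory Submission
  imports Defs
begin

text \<open>Write \<open>\<beta>\<close> for the maximum ergodic average and \<open>g = f - \<beta>\<close>; the interesting case is that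
  \<open>\<beta>\<close> is finite. Let \<open>v y\<close> be the supremum of the sums of \<open>g\<close> along all finite
  orbits that end at \<open>y\<close>, including the trivial orbit with sum \<open>0\<close>. Appending the arrow
  \<open>(x, y)\<close> to an orbit that ends at \<open>x\<close> gives \<open>g (x, y) + v x \<le> v y\<close>, which is the claim.
  What remains is that \<open>v\<close> is finite and Hoelder.

  Both rest on contraction in backward time. Openness and expansion together say that an arrow into
  \<open>y\<close> can be matched by an arrow into any nearby \<open>y'\<close>, from a starting point that is closer
  by a factor \<open>\<theta> < 1\<close> (\<open>open_expanding_contracting_preimages\<close>). Hence an orbit
  ending at \<open>y\<close> is shadowed, exponentially well in backward time, by one ending at \<open>y'\<close>
  (\<open>backward_shadowing\<close>), and the two sums of a Hoelder function differ by at most a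
  constant times \<open>dist y y' powr \<alpha>\<close>, whatever the length (\<open>orbit_sum_shadowing\<close>).
  This is the Hoelder estimate for \<open>v\<close>.

  For finiteness, periodic orbits suffice. The equidistribution on a periodic orbit is an invariant
  measure, so the sum of \<open>g\<close> over a period is at most \<open>0\<close>
  (\<open>periodic_orbit_sum_le_max_ergodic_average\<close>). An orbit segment that nearly returns to its
  starting point is shadowed by a periodic orbit (\<open>closing\<close>), so its sum is bounded by a
  constant. Cut \<open>X\<close> into finitely many small pieces. Any orbit
  consists of nearly returning segments, at most one for each piece, joined by single steps: from
  the current piece jump to the last visit to it, then take one step and never see that piece
  again. The number of segments is at most the number of pieces
  (\<open>orbit_sum_le_card_labels\<close>), and this bounds all orbit sums.\<close>

section \<open>Backward orbits and shadowing\<close>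

text \<open>Orbits are indexed backward in time, with the end point at index \<open>0\<close>: it is the
  end point that gets perturbed, and distances shrink as the index grows.\<close>

definition backward_orbit :: "('a \<times> 'a) set \<Rightarrow> nat \<Rightarrow> (nat \<Rightarrow> 'a) \<Rightarrow> bool" where
  "backward_orbit E n z \<longleftrightarrow> (\<forall>k<n. (z (Suc k), z k) \<in> E)"

definition orbit_sum :: "('a \<times> 'a \<Rightarrow> real) \<Rightarrow> nat \<Rightarrow> (nat \<Rightarrow> 'a) \<Rightarrow> real" where
  "orbit_sum g n z = (\<Sum>k<n. g (z (Suc k), z k))"

text \<open>This is how openness and expansion enter all later arguments: a uniform contraction of
  local inverse branches.\<close>

definition contracting_preimages ::
    "'a::metric_space set \<Rightarrow> ('a \<times> 'a) set \<Rightarrow> real \<Rightarrow> real \<Rightarrow> bool" where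
  "contracting_preimages X E \<theta> \<delta> \<longleftrightarrow>
     (\<forall>x y y'. (x, y) \<in> E \<longrightarrow> y' \<in> X \<longrightarrow> dist y y' < \<delta> \<longrightarrow>
        (\<exists>x'. (x', y') \<in> E \<and> dist x x' \<le> \<theta> * dist y y'))"

lemma orbit_sum_0 [simp]: "orbit_sum g 0 z = 0"
  by (simp add: orbit_sum_def)

lemma orbit_sum_shift:
  assumes "j \<le> n"
  shows "orbit_sum g n z = orbit_sum g j z + orbit_sum g (n - j) (\<lambda>k. z (k + j))"
proof -
  have "(\<Sum>k<n. g (z (Suc k), z k)) = (\<Sum>k<j. g (z (Suc k), z k)) + (\<Sum>k=j..<n. g (z (Suc k), z k))"
    using assms sum.atLeastLessThan_concat[of 0 j n "\<lambda>k. g (z (Suc k), z k)"]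
    by (simp add: atLeast0LessThan)
  moreover have "(\<Sum>k=j..<n. g (z (Suc k), z k)) = (\<Sum>k<n-j. g (z (Suc (k + j)), z (k + j)))"
    using assms sum.shift_bounds_nat_ivl[of "\<lambda>k. g (z (Suc k), z k)" 0 j "n - j"]
    by (simp add: atLeast0LessThan)
  ultimately show ?thesis
    by (simp add: orbit_sum_def)
qed

lemma backward_orbit_mono: "backward_orbit E n z \<Longrightarrow> j \<le> n \<Longrightarrow> backward_orbit E j z"
  by (simp add: backward_orbit_def)

lemma backward_orbit_shift:
  "backward_orbit E n z \<Longrightarrow> j \<le> n \<Longrightarrow> backward_orbit E (n - j) (\<lambda>k. z (k + j))"
  by (simp add: backward_orbit_def)

lemma backward_orbit_in:
  assumes "backward_orbit E n z" "E \<subseteq> X \<times> X" "z 0 \<in> X" "k \<le> n"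
  shows "z k \<in> X"
  using assms by (cases k) (auto simp: backward_orbit_def Suc_le_eq)

text \<open>Openness lifts points near \<open>y\<close> to points near \<open>x\<close>, and expansion then
  improves the rough closeness of the lift to a contraction. Compactness of the graph makes the
  admissible distance uniform.\<close>

lemma open_expanding_contracting_preimages:
  fixes X :: "'a::metric_space set"
  assumes "set_valued_map_on X T" "open_set_valued_on X T" "expanding_on X T" "compact (gr X T)"
  obtains \<theta> \<delta> where "0 < \<theta>" "\<theta> < 1" "0 < \<delta>" "contracting_preimages X (gr X T) \<theta> \<delta>"
proof -
  obtain L \<eta> where L: "L > 1" and \<eta>: "\<eta> > 0"
    and exp: "\<And>x y. x \<in> X \<Longrightarrow> y \<in> X \<Longrightarrow> dist x y \<le> \<eta> \<Longrightarrow>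
        ereal (L * dist x y) \<le> Inf {ereal (dist x' y') | x' y'. x' \<in> T x \<and> y' \<in> T y}"
    using assms(3) unfolding expanding_on_def by auto
  \<comment> \<open>The radius is \<open>2 * s\<close>, so that a ball of radius \<open>s\<close> is left for moving \<open>y\<close> within a
     finite cover; likewise \<open>\<eta> / 2\<close> for \<open>x\<close>.\<close>
  have local: "\<exists>s>0. \<forall>y'\<in>X. dist y y' < 2 * s \<longrightarrow> (\<exists>x'\<in>X. dist x x' < \<eta> / 2 \<and> y' \<in> T x')"
    if xy: "(x, y) \<in> gr X T" for x y
  proof -
    let ?A = "X \<inter> ball x (\<eta> / 2)"
    have "openin (top_of_set X) (\<Union>u\<in>?A. T u)"
      using assms(2) by (auto simp: open_set_valued_on_def openin_open_Int)
    moreover have "y \<in> (\<Union>u\<in>?A. T u)"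
      using xy \<eta> by (auto simp: gr_def)
    ultimately obtain e where e: "e > 0" "ball y e \<inter> X \<subseteq> (\<Union>u\<in>?A. T u)"
      by (metis openin_contains_ball)
    have "\<exists>x'\<in>X. dist x x' < \<eta> / 2 \<and> y' \<in> T x'" if "y' \<in> X" "dist y y' < e" for y'
    proof -
      have "y' \<in> (\<Union>u\<in>?A. T u)"
        using e(2) that by auto
      then show ?thesis
        by auto
    qed
    then show ?thesis
      using e(1) by (intro exI[of _ "e / 2"]) simp
  qed
  then obtain s where s: "\<And>x y. (x, y) \<in> gr X T \<Longrightarrow> s (x, y) > 0"
    and lift: "\<And>x y y'. (x, y) \<in> gr X T \<Longrightarrow> y' \<in> X \<Longrightarrow> dist y y' < 2 * s (x, y) \<Longrightarrow>
          \<exists>x'\<in>X. dist x x' < \<eta> / 2 \<and> y' \<in> T x'"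
  proof -
    have "\<forall>p\<in>gr X T. \<exists>s>0. \<forall>y'\<in>X. dist (snd p) y' < 2 * s \<longrightarrow>
        (\<exists>x'\<in>X. dist (fst p) x' < \<eta> / 2 \<and> y' \<in> T x')"
      using local by auto
    then obtain s where "\<forall>p\<in>gr X T. s p > 0 \<and> (\<forall>y'\<in>X. dist (snd p) y' < 2 * s p \<longrightarrow>
        (\<exists>x'\<in>X. dist (fst p) x' < \<eta> / 2 \<and> y' \<in> T x'))"
      by metis
    then show ?thesis
      by (intro that[of s]) force+
  qed
  obtain P where P: "P \<subseteq> gr X T" "finite P"
    and cover: "gr X T \<subseteq> (\<Union>p\<in>P. ball (fst p) (\<eta> / 2) \<times> ball (snd p) (s p))"
  proof (rule compactE_image[OF assms(4), of "gr X T" "\<lambda>p. ball (fst p) (\<eta> / 2) \<times> ball (snd p) (s p)"])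
    show "gr X T \<subseteq> (\<Union>p\<in>gr X T. ball (fst p) (\<eta> / 2) \<times> ball (snd p) (s p))"
      using s \<eta> by fastforce
  qed (auto intro: open_Times)
  \<comment> \<open>The element \<open>1\<close> only serves the case of an empty graph, where \<open>P\<close> may be empty.\<close>
  define \<delta> where "\<delta> = Min (insert 1 (s ` P))"
  have "\<delta> > 0"
    using P s unfolding \<delta>_def by (subst Min_gr_iff) auto
  have \<delta>_le: "\<delta> \<le> s p" if "p \<in> P" for p
    using P that unfolding \<delta>_def by (intro Min_le) auto
  have "\<exists>x'. (x', y') \<in> gr X T \<and> dist x x' \<le> 1 / L * dist y y'"
    if xy: "(x, y) \<in> gr X T" and y': "y' \<in> X" "dist y y' < \<delta>" for x y y'
  proof -
    obtain a b where ab: "(a, b) \<in> P" "dist a x < \<eta> / 2" "dist b y < s (a, b)"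
      using cover xy by fastforce
    have "dist b y' < 2 * s (a, b)"
      using ab y' \<delta>_le[OF ab(1)] dist_triangle[of b y' y] by simp
    then obtain x' where x': "x' \<in> X" "dist a x' < \<eta> / 2" "y' \<in> T x'"
      using lift ab P y' by blast
    have "dist x x' \<le> \<eta>"
      using ab x' dist_triangle3[of x x' a] by simp
    then have "ereal (L * dist x x') \<le> Inf {ereal (dist u u') | u u'. u \<in> T x \<and> u' \<in> T x'}"
      using exp xy x' by (auto simp: gr_def)
    also have "\<dots> \<le> ereal (dist y y')"
      using xy x' by (intro Inf_lower) (auto simp: gr_def)
    finally have "dist x x' \<le> 1 / L * dist y y'"
      using L by (simp add: field_simps)
    then show ?thesis
      using x' by (auto simp: gr_def)
  qed
  then have "contracting_preimages X (gr X T) (1 / L) \<delta>"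
    unfolding contracting_preimages_def by blast
  then show ?thesis
    using that[of "1 / L" \<delta>] L \<open>\<delta> > 0\<close> by simp
qed

text \<open>Lifting one arrow at a time works for every length because the distances shrink and so stay
  below the threshold \<open>\<delta>\<close>; one threshold therefore serves orbits of all lengths.\<close>

lemma backward_shadowing:
  fixes X :: "'a::metric_space set"
  assumes E: "E \<subseteq> X \<times> X" and contr: "contracting_preimages X E \<theta> \<delta>" and \<theta>: "0 < \<theta>" "\<theta> < 1"
    and z: "backward_orbit E n z" and y: "y \<in> X" "dist (z 0) y < \<delta>"
  shows "\<exists>w. w 0 = y \<and> backward_orbit E n w \<and> (\<forall>k\<le>n. dist (z k) (w k) \<le> \<theta> ^ k * dist (z 0) y)"
  using z
proof (induction n)
  case 0
  show ?case
    by (intro exI[of _ "\<lambda>_. y"]) (simp add: backward_orbit_def)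
next
  case (Suc n)
  then obtain w where w: "w 0 = y" "backward_orbit E n w"
    and close: "\<And>k. k \<le> n \<Longrightarrow> dist (z k) (w k) \<le> \<theta> ^ k * dist (z 0) y"
    by (metis backward_orbit_mono le_SucI order_refl)
  have "\<theta> ^ n * dist (z 0) y \<le> 1 * dist (z 0) y"
    using \<theta> by (intro mult_right_mono power_le_one) auto
  then have "dist (z n) (w n) < \<delta>"
    using close[of n] y by simp
  moreover have "w n \<in> X"
    using backward_orbit_in[OF w(2) E] w(1) y by simp
  moreover have "(z (Suc n), z n) \<in> E"
    using Suc.prems by (simp add: backward_orbit_def)
  ultimately obtain u where u: "(u, w n) \<in> E" "dist (z (Suc n)) u \<le> \<theta> * dist (z n) (w n)"
    using contr unfolding contracting_preimages_def by blast
  have "\<theta> * dist (z n) (w n) \<le> \<theta> * (\<theta> ^ n * dist (z 0) y)"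
    using close[of n] \<theta> by (intro mult_left_mono) auto
  then have "dist (z (Suc n)) u \<le> \<theta> ^ Suc n * dist (z 0) y"
    using u by simp
  then show ?case
    using w u close
    by (intro exI[of _ "w(Suc n := u)"]) (auto simp: backward_orbit_def less_Suc_eq le_Suc_eq)
qed

lemma Cauchy_geometric_steps:
  fixes s :: "nat \<Rightarrow> 'a::metric_space"
  assumes step: "\<And>j. dist (s j) (s (Suc j)) \<le> \<theta> ^ j * a" and \<theta>: "0 < \<theta>" "\<theta> < 1" and a: "0 \<le> a"
  shows "Cauchy s" and "dist (s 0) (s j) \<le> a / (1 - \<theta>)"
proof -
  have tail: "dist (s i) (s (i + j)) \<le> \<theta> ^ i * a * (1 - \<theta> ^ j) / (1 - \<theta>)" for i j
  proof (induction j)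
    case (Suc j)
    have "dist (s i) (s (i + Suc j)) \<le> \<theta> ^ i * a * (1 - \<theta> ^ j) / (1 - \<theta>) + \<theta> ^ (i + j) * a"
      using dist_triangle[of "s i" "s (i + Suc j)" "s (i + j)"] Suc step[of "i + j"] by simp
    also have "\<dots> = \<theta> ^ i * a * (1 - \<theta> ^ Suc j) / (1 - \<theta>)"
      using \<theta> by (simp add: field_simps power_add)
    finally show ?case .
  qed simp
  have bound: "dist (s i) (s (i + j)) \<le> \<theta> ^ i * (a / (1 - \<theta>))" for i j
  proof -
    have "\<theta> ^ i * a * (1 - \<theta> ^ j) \<le> \<theta> ^ i * a * 1"
      using \<theta> a by (intro mult_left_mono) auto
    then have "\<theta> ^ i * a * (1 - \<theta> ^ j) / (1 - \<theta>) \<le> \<theta> ^ i * a / (1 - \<theta>)"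
      using \<theta> by (intro divide_right_mono) auto
    then show ?thesis
      using tail[of i j] by simp
  qed
  show "dist (s 0) (s j) \<le> a / (1 - \<theta>)"
    using bound[of 0 j] by simp
  show "Cauchy s"
  proof (rule metric_CauchyI)
    fix e :: real
    assume "e > 0"
    have "(\<lambda>i. \<theta> ^ i * (a / (1 - \<theta>))) \<longlonglongrightarrow> 0"
      using \<theta> by (intro tendsto_mult_left_zero LIMSEQ_realpow_zero) auto
    then obtain M where M: "\<theta> ^ M * (a / (1 - \<theta>)) < e / 2"
      using \<open>e > 0\<close> by (metis (no_types, lifting) eventually_sequentially half_gt_zero order_refl
          order_tendstoD(2))
    have near: "dist (s M) (s n) < e / 2" if "n \<ge> M" for n
      using le_less_trans[OF bound[of M "n - M"] M] that by simp
    have "dist (s m) (s n) < e" if "m \<ge> M" "n \<ge> M" for m n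
      using near[OF that(1)] near[OF that(2)] dist_triangle3[of "s m" "s n" "s M"] by simp
    then show "\<exists>M. \<forall>m\<ge>M. \<forall>n\<ge>M. dist (s m) (s n) < e"
      by blast
  qed
qed

text \<open>A closing lemma. Extend the almost closed orbit backward, past its earliest point
  \<open>z m\<close>, by shadowing the whole block from there, and repeat. Successive blocks
  differ by geometrically small amounts, so they converge; as each block begins where the previous one
  stops, the limit is periodic. The exponential weight \<open>\<theta> ^ k\<close> in the estimate is
  what makes orbit sums comparable independently of the period.\<close>

lemma closing:
  fixes X :: "'a::metric_space set"
  assumes X: "compact X" and E: "E \<subseteq> X \<times> X" "closed E"
    and contr: "contracting_preimages X E \<theta> \<delta>" and \<theta>: "0 < \<theta>" "\<theta> < 1"
    and z: "backward_orbit E m z" "m > 0" and close: "dist (z 0) (z m) < \<delta>"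
  obtains p where "backward_orbit E m p" "p m = p 0"
    "\<And>k. k \<le> m \<Longrightarrow> dist (z k) (p k) \<le> \<theta> ^ k * (\<delta> / (1 - \<theta>))"
proof -
  define \<epsilon> where "\<epsilon> = dist (z 0) (z m)"
  have zX: "w 0 \<in> X" "w m \<in> X" if "backward_orbit E m w" for w
    using that z(2) E(1) backward_orbit_in[of E m w X] by (auto simp: backward_orbit_def)
  \<comment> \<open>Each block starts where the previous one ends and shadows it, so the gap between the two
     ends of a block shrinks geometrically.\<close>
  obtain W where W: "\<And>j. backward_orbit E m (W j)" "W 0 = z"
    and gap: "\<And>j. dist (W j 0) (W j m) \<le> \<theta> ^ j * \<epsilon>"
    and next0: "\<And>j. W (Suc j) 0 = W j m"
    and step: "\<And>j k. k \<le> m \<Longrightarrow> dist (W j k) (W (Suc j) k) \<le> \<theta> ^ k * dist (W j 0) (W j m)"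
  proof -
    let ?P = "\<lambda>j w. (j = 0 \<longrightarrow> w = z) \<and> backward_orbit E m w \<and> dist (w 0) (w m) \<le> \<theta> ^ j * \<epsilon>"
    let ?Q = "\<lambda>(j::nat) w w'. w' 0 = w m \<and>
        (\<forall>k\<le>m. dist (w k) (w' k) \<le> \<theta> ^ k * dist (w 0) (w m))"
    have start: "\<exists>w. ?P 0 w"
      using z by (auto simp: \<epsilon>_def)
    have extend: "\<exists>w'. ?P (Suc j) w' \<and> ?Q j w w'" if w: "?P j w" for j w
    proof -
      have "\<theta> ^ j * \<epsilon> \<le> 1 * \<epsilon>"
        using \<theta> by (intro mult_right_mono power_le_one) (auto simp: \<epsilon>_def)
      then have "dist (w 0) (w m) < \<delta>"
        using w close by (simp add: \<epsilon>_def)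
      then obtain w' where w': "w' 0 = w m" "backward_orbit E m w'"
        "\<forall>k\<le>m. dist (w k) (w' k) \<le> \<theta> ^ k * dist (w 0) (w m)"
        using backward_shadowing[OF E(1) contr \<theta>, of m w "w m"] w zX by blast
      have "\<theta> ^ m \<le> \<theta>"
        using \<theta> z(2) power_decreasing[of 1 m \<theta>] by simp
      then have "\<theta> ^ m * dist (w 0) (w m) \<le> \<theta> * (\<theta> ^ j * \<epsilon>)"
        using w \<theta> by (intro mult_mono) auto
      then have "dist (w' 0) (w' m) \<le> \<theta> ^ Suc j * \<epsilon>"
        using w' by force
      with w' show ?thesis
        by blast
    qed
    obtain W where "\<forall>j. ?P j (W j)" "\<forall>j. ?Q j (W j) (W (Suc j))"
      using dependent_nat_choice[of ?P ?Q, OF start extend] by blast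
    then show ?thesis
      by (intro that[of W]) auto
  qed
  have step': "dist (W j k) (W (Suc j) k) \<le> \<theta> ^ j * (\<theta> ^ k * \<epsilon>)" if "k \<le> m" for j k
  proof -
    have "\<theta> ^ k * dist (W j 0) (W j m) \<le> \<theta> ^ k * (\<theta> ^ j * \<epsilon>)"
      using gap[of j] \<theta> by (intro mult_left_mono) auto
    then show ?thesis
      using step[OF that, of j] by (simp add: mult.left_commute)
  qed
  have "\<epsilon> \<ge> 0"
    by (simp add: \<epsilon>_def)
  have WX: "W j k \<in> X" if "k \<le> m" for j k
    using backward_orbit_in[OF W(1) E(1) zX(1)[OF W(1)] that] .
  have "\<exists>l. (\<lambda>j. W j k) \<longlonglongrightarrow> l" if "k \<le> m" for k
  proof -
    have "Cauchy (\<lambda>j. W j k)"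
      using step'[OF that] \<theta> \<open>\<epsilon> \<ge> 0\<close> by (intro Cauchy_geometric_steps(1)[where a = "\<theta> ^ k * \<epsilon>"]) auto
    then show ?thesis
      using compact_imp_complete[OF X] WX[OF that] unfolding complete_def by fast
  qed
  then obtain p where lim: "\<And>k. k \<le> m \<Longrightarrow> (\<lambda>j. W j k) \<longlonglongrightarrow> p k"
    by metis
  show ?thesis
  proof
    show "backward_orbit E m p"
      unfolding backward_orbit_def
    proof (intro allI impI)
      fix k
      assume "k < m"
      then have lims: "(\<lambda>j. (W j (Suc k), W j k)) \<longlonglongrightarrow> (p (Suc k), p k)"
        by (intro tendsto_Pair lim) auto
      have inE: "(W j (Suc k), W j k) \<in> E" for j
        using W(1) \<open>k < m\<close> by (simp add: backward_orbit_def)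
      show "(p (Suc k), p k) \<in> E"
        by (rule closed_sequentially[OF E(2) inE lims])
    qed
    have "(\<lambda>j. W (Suc j) 0) \<longlonglongrightarrow> p m"
      unfolding next0 by (rule lim) simp
    moreover have "(\<lambda>j. W (Suc j) 0) \<longlonglongrightarrow> p 0"
      by (intro LIMSEQ_Suc lim) simp
    ultimately show "p m = p 0"
      by (rule LIMSEQ_unique)
    fix k
    assume k: "k \<le> m"
    have near: "dist (W 0 k) (W j k) \<le> \<theta> ^ k * \<epsilon> / (1 - \<theta>)" for j
      using step'[OF k] \<theta> \<open>\<epsilon> \<ge> 0\<close>
      by (intro Cauchy_geometric_steps(2)[where a = "\<theta> ^ k * \<epsilon>"]) auto
    have "(\<lambda>j. dist (W 0 k) (W j k)) \<longlonglongrightarrow> dist (W 0 k) (p k)"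
      by (intro tendsto_dist tendsto_const lim k)
    then have "dist (W 0 k) (p k) \<le> \<theta> ^ k * \<epsilon> / (1 - \<theta>)"
      using near by (intro LIMSEQ_le_const2[where X = "\<lambda>j. dist (W 0 k) (W j k)"]) auto
    then have "dist (z k) (p k) \<le> \<theta> ^ k * \<epsilon> / (1 - \<theta>)"
      using W(2) by simp
    also have "\<dots> \<le> \<theta> ^ k * \<delta> / (1 - \<theta>)"
      using close \<theta> by (intro divide_right_mono mult_left_mono) (auto simp: \<epsilon>_def)
    finally show "dist (z k) (p k) \<le> \<theta> ^ k * (\<delta> / (1 - \<theta>))"
      by simp
  qed
qed

section \<open>Orbit sums of Hoelder functions\<close>

text \<open>The differences of the summands form a geometric series with ratio
  \<open>\<theta> powr \<alpha>\<close>, which gives a bound that does not depend on the length.\<close>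

lemma orbit_sum_shadowing:
  fixes z w :: "nat \<Rightarrow> 'a::metric_space"
  assumes K: "0 < K" and hoelder: "\<And>p q. p \<in> E \<Longrightarrow> q \<in> E \<Longrightarrow> \<bar>g p - g q\<bar> \<le> K * max_dist p q powr \<alpha>"
    and \<alpha>: "0 < \<alpha>" and \<theta>: "0 < \<theta>" "\<theta> < 1" and a: "0 \<le> a"
    and orb: "backward_orbit E n z" "backward_orbit E n w"
    and close: "\<And>k. k \<le> n \<Longrightarrow> dist (z k) (w k) \<le> \<theta> ^ k * a"
  shows "orbit_sum g n z \<le> orbit_sum g n w + K / (1 - \<theta> powr \<alpha>) * a powr \<alpha>"
proof -
  have r: "0 < \<theta> powr \<alpha>" "\<theta> powr \<alpha> < 1"
    using \<theta> \<alpha> powr_less_mono2[of \<alpha> \<theta> 1] by auto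
  have "orbit_sum g n z - orbit_sum g n w = (\<Sum>k<n. g (z (Suc k), z k) - g (w (Suc k), w k))"
    by (simp add: orbit_sum_def sum_subtractf)
  also have "\<dots> \<le> (\<Sum>k<n. K * a powr \<alpha> * (\<theta> powr \<alpha>) ^ k)"
  proof (rule sum_mono)
    fix k
    assume "k \<in> {..<n}"
    then have k: "k < n"
      by simp
    have "\<theta> ^ Suc k * a \<le> \<theta> ^ k * a"
      using \<theta> a by (intro mult_right_mono power_decreasing) auto
    then have "max_dist (z (Suc k), z k) (w (Suc k), w k) \<le> \<theta> ^ k * a"
      using close[of k] close[of "Suc k"] k by (simp add: max_dist_def)
    then have "max_dist (z (Suc k), z k) (w (Suc k), w k) powr \<alpha> \<le> (\<theta> ^ k * a) powr \<alpha>"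
      using \<alpha> by (intro powr_mono2) (auto simp: max_dist_def le_max_iff_disj)
    also have "\<dots> = a powr \<alpha> * (\<theta> powr \<alpha>) ^ k"
      using \<theta> a by (simp add: powr_mult powr_powr powr_realpow[symmetric] mult.commute)
    finally have "K * max_dist (z (Suc k), z k) (w (Suc k), w k) powr \<alpha> \<le> K * (a powr \<alpha> * (\<theta> powr \<alpha>) ^ k)"
      using K by (intro mult_left_mono) auto
    then show "g (z (Suc k), z k) - g (w (Suc k), w k) \<le> K * a powr \<alpha> * (\<theta> powr \<alpha>) ^ k"
      using hoelder[of "(z (Suc k), z k)" "(w (Suc k), w k)"] orb k
      by (auto simp: backward_orbit_def mult.assoc)
  qed
  also have "\<dots> = K * a powr \<alpha> * ((1 - (\<theta> powr \<alpha>) ^ n) / (1 - \<theta> powr \<alpha>))"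
    using r by (simp add: sum_distrib_left[symmetric] sum_gp_strict)
  also have "\<dots> \<le> K * a powr \<alpha> * (1 / (1 - \<theta> powr \<alpha>))"
    using r K by (intro mult_left_mono divide_right_mono) auto
  finally show ?thesis
    by (simp add: algebra_simps)
qed

text \<open>Induction on the number of labels: cut at the last index that carries the label of
  the end point \<open>z 0\<close>. The part up to there is a return, bounded by \<open>A\<close>; one more step costs at
  most \<open>B\<close>; the rest avoids that label.\<close>

lemma orbit_sum_le_card_labels:
  assumes "finite C"
    and ret: "\<And>z m. m > 0 \<Longrightarrow> backward_orbit E m z \<Longrightarrow> lab (z 0) = lab (z m) \<Longrightarrow> orbit_sum g m z \<le> A"
    and one: "\<And>p. p \<in> E \<Longrightarrow> g p \<le> B" and AB: "0 \<le> A" "0 \<le> B"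
    and z: "backward_orbit E n z" "\<And>k. k \<le> n \<Longrightarrow> lab (z k) \<in> C"
  shows "orbit_sum g n z \<le> real (card C) * (A + B)"
  using assms(1) z
proof (induction "card C" arbitrary: C n z)
  case 0
  then show ?case
    by (metis card_0_eq empty_iff le0)
next
  case (Suc N)
  define j where "j = (GREATEST j. j \<le> n \<and> lab (z j) = lab (z 0))"
  have j: "j \<le> n" "lab (z j) = lab (z 0)"
    using GreatestI_nat[of "\<lambda>j. j \<le> n \<and> lab (z j) = lab (z 0)" 0 n] by (auto simp: j_def)
  have last: "i \<le> j" if "i \<le> n" "lab (z i) = lab (z 0)" for i
    using Greatest_le_nat[of "\<lambda>j. j \<le> n \<and> lab (z j) = lab (z 0)" i n] that by (auto simp: j_def)
  have head: "orbit_sum g j z \<le> A"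
    using j AB ret[of j z] backward_orbit_mono[OF Suc.prems(2)] by (cases "j = 0") auto
  have cardC: "real (card C) = real N + 1"
    using Suc.hyps(2) by linarith
  show ?case
  proof (cases "j = n")
    case True
    have "1 * (A + B) \<le> real (card C) * (A + B)"
      using AB cardC by (intro mult_right_mono) auto
    with head True AB show ?thesis
      by simp
  next
    case False
    then have "Suc j \<le> n"
      using j by simp
    let ?w = "\<lambda>k. z (k + Suc j)"
    have "orbit_sum g (n - Suc j) ?w \<le> real (card (C - {lab (z 0)})) * (A + B)"
    proof (rule Suc.hyps(1))
      show "N = card (C - {lab (z 0)})"
        using Suc.hyps(2) Suc.prems by simp
      show "finite (C - {lab (z 0)})"
        using Suc.prems by simp
      show "backward_orbit E (n - Suc j) ?w"
        using Suc.prems(2) \<open>Suc j \<le> n\<close> by (rule backward_orbit_shift)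
      show "lab (?w k) \<in> C - {lab (z 0)}" if "k \<le> n - Suc j" for k
      proof -
        have "k + Suc j \<le> n"
          using that \<open>Suc j \<le> n\<close> by simp
        then show ?thesis
          using Suc.prems(3)[of "k + Suc j"] last[of "k + Suc j"] by force
      qed
    qed
    also have "card (C - {lab (z 0)}) = N"
      using Suc.hyps(2) Suc.prems by simp
    finally have tail: "orbit_sum g (n - Suc j) ?w \<le> real N * (A + B)" .
    have "orbit_sum g (Suc j) z = orbit_sum g j z + g (z (Suc j), z j)"
      by (simp add: orbit_sum_def)
    moreover have "g (z (Suc j), z j) \<le> B"
      using one Suc.prems(2) \<open>Suc j \<le> n\<close> by (simp add: backward_orbit_def)
    ultimately show ?thesis
      using orbit_sum_shift[OF \<open>Suc j \<le> n\<close>, of g z] head tail cardC by (simp add: algebra_simps)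
  qed
qed

text \<open>Labels stand for the pieces of a partition of \<open>X\<close> into finitely many sets whose points are
  less than \<open>\<delta>\<close> apart: each point is labelled by a nearby point of a finite net.\<close>

lemma compact_finite_labelling:
  fixes X :: "'a::metric_space set"
  assumes "compact X" "\<delta> > 0"
  obtains lab :: "'a \<Rightarrow> 'a" and C where "finite C" "\<And>x. x \<in> X \<Longrightarrow> lab x \<in> C"
    "\<And>x y. x \<in> X \<Longrightarrow> y \<in> X \<Longrightarrow> lab x = lab y \<Longrightarrow> dist x y < \<delta>"
proof -
  obtain C where C: "finite C" "X \<subseteq> (\<Union>c\<in>C. ball c (\<delta> / 2))"
  proof (rule compactE_image[OF assms(1), of X "\<lambda>c. ball c (\<delta> / 2)"])
    show "X \<subseteq> (\<Union>c\<in>X. ball c (\<delta> / 2))"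
      using assms(2) by auto
  qed auto
  then have "\<forall>x\<in>X. \<exists>c\<in>C. dist c x < \<delta> / 2"
    by fastforce
  then obtain lab where lab: "\<forall>x\<in>X. lab x \<in> C \<and> dist (lab x) x < \<delta> / 2"
    by metis
  show ?thesis
  proof (rule that[OF C(1), of lab])
    show "lab x \<in> C" if "x \<in> X" for x
      using lab that by blast
    show "dist x y < \<delta>" if "x \<in> X" "y \<in> X" "lab x = lab y" for x y
      using lab that dist_triangle_half_r[of "lab x" x \<delta> y] by metis
  qed
qed

lemma hoelder_continuous_on:
  fixes g :: "'a::metric_space \<times> 'a \<Rightarrow> real"
  assumes "holder_on E max_dist \<alpha> g" "0 < \<alpha>"
  shows "continuous_on E g"
  unfolding continuous_on_def
proof
  fix p
  assume p: "p \<in> E"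
  obtain K where K: "K > 0" "\<And>p q. p \<in> E \<Longrightarrow> q \<in> E \<Longrightarrow> \<bar>g p - g q\<bar> \<le> K * max_dist p q powr \<alpha>"
    using assms(1) unfolding holder_on_def by blast
  have lim: "((\<lambda>q. K * dist q p powr \<alpha>) \<longlongrightarrow> 0) (at p within E)"
  proof (rule tendsto_mult_right_zero)
    have "((\<lambda>q. dist q p) \<longlongrightarrow> dist p p) (at p within E)"
      by (intro tendsto_intros)
    then show "((\<lambda>q. dist q p powr \<alpha>) \<longlongrightarrow> 0) (at p within E)"
      using assms(2) by (intro tendsto_zero_powrI[where b = \<alpha>]) auto
  qed
  have "\<bar>g q - g p\<bar> \<le> K * dist q p powr \<alpha>" if "q \<in> E" for q
  proof -
    have "max_dist q p \<le> dist q p"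
      by (simp add: max_dist_def dist_fst_le dist_snd_le)
    then have "max_dist q p powr \<alpha> \<le> dist q p powr \<alpha>"
      using assms(2) by (intro powr_mono2) (auto simp: max_dist_def le_max_iff_disj)
    then show ?thesis
      using K(2)[OF that p] K(1) by (meson mult_left_mono order_trans less_imp_le)
  qed
  then have near: "\<forall>\<^sub>F q in at p within E. norm (g q - g p) \<le> K * dist q p powr \<alpha>"
    by (auto simp: eventually_at_filter)
  have "((\<lambda>q. g q - g p) \<longlongrightarrow> 0) (at p within E)"
    by (rule Lim_null_comparison[OF near lim])
  then show "(g \<longlongrightarrow> g p) (at p within E)"
    by (rule Lim_null[THEN iffD2])
qed

section \<open>Construction of the sub-action\<close>

text \<open>Two points with equal labels are close enough for the closing lemma, so a return has a sum at
  most that of a periodic orbit plus the shadowing error.\<close>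

lemma orbit_sum_bounded_above:
  fixes X :: "'a::metric_space set"
  assumes X: "compact X" and E: "E \<subseteq> X \<times> X" "compact E"
    and contr: "contracting_preimages X E \<theta> \<delta>" and \<theta>: "0 < \<theta>" "\<theta> < 1" and \<delta>: "0 < \<delta>"
    and g: "holder_on E max_dist \<alpha> g" and \<alpha>: "0 < \<alpha>"
    and per: "\<And>m p. m > 0 \<Longrightarrow> backward_orbit E m p \<Longrightarrow> p m = p 0 \<Longrightarrow> orbit_sum g m p \<le> 0"
  obtains M where "0 \<le> M" "\<And>n z. z 0 \<in> X \<Longrightarrow> backward_orbit E n z \<Longrightarrow> orbit_sum g n z \<le> M"
proof -
  obtain K where K: "K > 0" "\<And>p q. p \<in> E \<Longrightarrow> q \<in> E \<Longrightarrow> \<bar>g p - g q\<bar> \<le> K * max_dist p q powr \<alpha>"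
    using g unfolding holder_on_def by blast
  obtain lab :: "'a \<Rightarrow> 'a" and C where C: "finite C" "\<And>x. x \<in> X \<Longrightarrow> lab x \<in> C"
    and near: "\<And>x y. x \<in> X \<Longrightarrow> y \<in> X \<Longrightarrow> lab x = lab y \<Longrightarrow> dist x y < \<delta>"
    by (rule compact_finite_labelling[OF X \<delta>]) (rule that)
  have "bounded (g ` E)"
    using compact_continuous_image[OF hoelder_continuous_on[OF g \<alpha>] E(2)] compact_imp_bounded by blast
  then obtain B where B: "B > 0" "\<And>p. p \<in> E \<Longrightarrow> \<bar>g p\<bar> \<le> B"
    by (auto simp: bounded_pos)
  define A where "A = K / (1 - \<theta> powr \<alpha>) * (\<delta> / (1 - \<theta>)) powr \<alpha>"
  have "\<theta> powr \<alpha> < 1"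
    using \<theta> \<alpha> powr_less_mono2[of \<alpha> \<theta> 1] by simp
  then have "A \<ge> 0"
    using K(1) by (simp add: A_def)
  have ret: "orbit_sum g m z \<le> A"
    if m: "m > 0" and z: "backward_orbit E m z" and same: "lab (z 0) = lab (z m)" for z m
  proof -
    have "z 0 \<in> X"
      using z m E(1) by (auto simp: backward_orbit_def)
    then have "dist (z 0) (z m) < \<delta>"
      using near same backward_orbit_in[OF z E(1)] by simp
    then obtain p where p: "backward_orbit E m p" "p m = p 0"
      "\<And>k. k \<le> m \<Longrightarrow> dist (z k) (p k) \<le> \<theta> ^ k * (\<delta> / (1 - \<theta>))"
      using closing[OF X E(1) compact_imp_closed[OF E(2)] contr \<theta> z m] by blast
    have "orbit_sum g m z \<le> orbit_sum g m p + A"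
      unfolding A_def using \<theta> \<delta> p by (intro orbit_sum_shadowing[OF K \<alpha> \<theta> _ z]) auto
    then show ?thesis
      using per[OF m p(1,2)] by simp
  qed
  show ?thesis
  proof (rule that[of "real (card C) * (A + B)"])
    show "0 \<le> real (card C) * (A + B)"
      using \<open>A \<ge> 0\<close> B(1) by simp
    show "orbit_sum g n z \<le> real (card C) * (A + B)" if z: "z 0 \<in> X" "backward_orbit E n z" for n z
    proof (rule orbit_sum_le_card_labels[OF C(1) ret _ \<open>A \<ge> 0\<close> _ z(2)])
      show "g p \<le> B" if "p \<in> E" for p
        using B(2)[OF that] by simp
      show "lab (z k) \<in> C" if "k \<le> n" for k
        using C(2) backward_orbit_in[OF z(2) E(1) z(1) that] by blast
    qed (use B(1) in auto)
  qed
qed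

text \<open>The sub-action is the supremum of the sums over all orbits ending at a given point. At
  distances below \<open>\<delta>\<close> its Hoelder estimate comes from shadowing; at larger distances it
  follows from \<open>0 \<le> v \<le> M\<close>.\<close>

lemma exists_hoelder_subaction:
  fixes X :: "'a::metric_space set"
  assumes X: "compact X" and E: "E \<subseteq> X \<times> X" "compact E"
    and contr: "contracting_preimages X E \<theta> \<delta>" and \<theta>: "0 < \<theta>" "\<theta> < 1" and \<delta>: "0 < \<delta>"
    and g: "holder_on E max_dist \<alpha> g" and \<alpha>: "0 < \<alpha>"
    and per: "\<And>m p. m > 0 \<Longrightarrow> backward_orbit E m p \<Longrightarrow> p m = p 0 \<Longrightarrow> orbit_sum g m p \<le> 0"
  shows "\<exists>v. holder_on X dist \<alpha> v \<and> (\<forall>(x, y)\<in>E. g (x, y) + v x \<le> v y)"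
proof -
  obtain K where K: "K > 0" "\<And>p q. p \<in> E \<Longrightarrow> q \<in> E \<Longrightarrow> \<bar>g p - g q\<bar> \<le> K * max_dist p q powr \<alpha>"
    using g unfolding holder_on_def by blast
  obtain M where M: "0 \<le> M" "\<And>n z. z 0 \<in> X \<Longrightarrow> backward_orbit E n z \<Longrightarrow> orbit_sum g n z \<le> M"
    using orbit_sum_bounded_above[OF assms] by blast
  define S where "S y = {orbit_sum g n z | n z. z 0 = y \<and> backward_orbit E n z}" for y
  define v where "v y = Sup (S y)" for y
  have S0: "0 \<in> S y" for y
    unfolding S_def by (force simp: backward_orbit_def intro: exI[of _ 0])
  have SM: "s \<le> M" if "s \<in> S y" "y \<in> X" for s y
    using that M(2) by (auto simp: S_def)
  have bdd: "bdd_above (S y)" if "y \<in> X" for y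
    using SM that by (meson bdd_aboveI)
  have upper: "s \<le> v y" if "s \<in> S y" "y \<in> X" for s y
    unfolding v_def using that bdd by (intro cSup_upper)
  have least: "v y \<le> b" if "\<And>s. s \<in> S y \<Longrightarrow> s \<le> b" for y b
    unfolding v_def using S0[of y] that by (intro cSup_least) auto
  have sub: "g (x, y) + v x \<le> v y" if xy: "(x, y) \<in> E" for x y
  proof -
    have "v x \<le> v y - g (x, y)"
    proof (rule least)
      fix s
      assume "s \<in> S x"
      then obtain n z where z: "s = orbit_sum g n z" "z 0 = x" "backward_orbit E n z"
        by (auto simp: S_def)
      let ?w = "\<lambda>k. case k of 0 \<Rightarrow> y | Suc i \<Rightarrow> z i"
      have "orbit_sum g (Suc n) ?w = g (x, y) + s"
        using z(1,2) orbit_sum_shift[of 1 "Suc n" g ?w] by (simp add: orbit_sum_def)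
      moreover have "backward_orbit E (Suc n) ?w"
        using xy z by (auto simp: backward_orbit_def split: nat.split)
      ultimately have "g (x, y) + s \<in> S y"
        unfolding S_def by (intro CollectI exI[of _ "Suc n"] exI[of _ ?w]) simp
      then show "s \<le> v y - g (x, y)"
        using upper[of "g (x, y) + s" y] xy E(1) by auto
    qed
    then show ?thesis
      by simp
  qed
  define R where "R = K / (1 - \<theta> powr \<alpha>)"
  have "\<theta> powr \<alpha> < 1"
    using \<theta> \<alpha> powr_less_mono2[of \<alpha> \<theta> 1] by simp
  then have R: "R > 0"
    using K(1) by (simp add: R_def)
  \<comment> \<open>The second summand is the constant for points at distance at least \<open>\<delta>\<close>, where the values
     of \<open>v\<close> differ by at most \<open>M\<close>.\<close>
  define H where "H = R + M / \<delta> powr \<alpha>"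
  have H: "R \<le> H" "M / \<delta> powr \<alpha> \<le> H" "H > 0"
    using R M(1) by (auto simp: H_def intro: add_pos_nonneg)
  have le: "v y - v y' \<le> H * dist y y' powr \<alpha>" if y: "y \<in> X" "y' \<in> X" for y y'
  proof (cases "dist y y' < \<delta>")
    case True
    have "v y \<le> v y' + R * dist y y' powr \<alpha>"
    proof (rule least)
      fix s
      assume "s \<in> S y"
      then obtain n z where z: "s = orbit_sum g n z" "z 0 = y" "backward_orbit E n z"
        by (auto simp: S_def)
      obtain w where w: "w 0 = y'" "backward_orbit E n w"
        "\<forall>k\<le>n. dist (z k) (w k) \<le> \<theta> ^ k * dist y y'"
        using backward_shadowing[OF E(1) contr \<theta> z(3) y(2)] True z(2) by auto
      have "orbit_sum g n z \<le> orbit_sum g n w + R * dist y y' powr \<alpha>"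
        unfolding R_def using w by (intro orbit_sum_shadowing[OF K \<alpha> \<theta> _ z(3)]) auto
      moreover have "orbit_sum g n w \<le> v y'"
        using w y by (intro upper) (auto simp: S_def)
      ultimately show "s \<le> v y' + R * dist y y' powr \<alpha>"
        using z by simp
    qed
    moreover have "R * dist y y' powr \<alpha> \<le> H * dist y y' powr \<alpha>"
      using H by (intro mult_right_mono) auto
    ultimately show ?thesis
      by simp
  next
    case False
    have "v y - v y' \<le> M"
      using least[of y M] SM[of _ y] y upper[OF S0, of y'] by fastforce
    also have "M = M / \<delta> powr \<alpha> * \<delta> powr \<alpha>"
      using \<delta> by simp
    also have "\<dots> \<le> H * dist y y' powr \<alpha>"
      using H False \<alpha> \<delta> by (intro mult_mono powr_mono2) auto
    finally show ?thesis .
  qed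
  have "\<bar>v y - v y'\<bar> \<le> H * dist y y' powr \<alpha>" if "y \<in> X" "y' \<in> X" for y y'
    using le[OF that] le[OF that(2,1)] by (simp add: abs_le_iff dist_commute)
  then have "holder_on X dist \<alpha> v"
    unfolding holder_on_def using H(3) by blast
  with sub show ?thesis
    by auto
qed

section \<open>Invariant measures on periodic orbits\<close>

text \<open>A push-forward of the uniform distribution on the time indices, so that a point visited
  several times during one period is counted with multiplicity.\<close>

definition periodic_orbit_measure ::
    "'y::topological_space set \<Rightarrow> nat \<Rightarrow> (nat \<Rightarrow> 'y) \<Rightarrow> 'y measure" where
  "periodic_orbit_measure Y m q =
     distr (measure_pmf (pmf_of_set {..<m})) (restrict_space borel Y) q"

lemma
  fixes Y :: "'y::t1_space set"
  assumes m: "m > 0" and q: "\<And>i. q i \<in> Y"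
  shows emeasure_periodic_orbit_measure:
      "A \<in> sets (restrict_space borel Y) \<Longrightarrow>
        emeasure (periodic_orbit_measure Y m q) A = ennreal (card {i\<in>{..<m}. q i \<in> A} / m)"
    and integral_periodic_orbit_measure:
      "continuous_on Y g \<Longrightarrow> (\<integral>y. g y \<partial>periodic_orbit_measure Y m q) = (\<Sum>i<m. g (q i)) / m"
    and prob_space_periodic_orbit_measure: "prob_space (periodic_orbit_measure Y m q)"
    and sets_periodic_orbit_measure:
      "sets (periodic_orbit_measure Y m q) = sets (restrict_space borel Y)"
proof -
  have ne: "{..<m} \<noteq> {}"
    using m by auto
  have meas: "q \<in> measurable (measure_pmf (pmf_of_set {..<m})) (restrict_space borel Y)"
    using q by (auto simp: space_restrict_space)
  show "sets (periodic_orbit_measure Y m q) = sets (restrict_space borel Y)"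
    by (simp add: periodic_orbit_measure_def)
  show "prob_space (periodic_orbit_measure Y m q)"
    unfolding periodic_orbit_measure_def by (intro measure_pmf.prob_space_distr meas)
  show "emeasure (periodic_orbit_measure Y m q) A = ennreal (card {i\<in>{..<m}. q i \<in> A} / m)"
    if "A \<in> sets (restrict_space borel Y)"
  proof -
    have "{..<m} \<inter> q -` A = {i\<in>{..<m}. q i \<in> A}"
      by auto
    then show ?thesis
      unfolding periodic_orbit_measure_def using that ne
      by (simp add: emeasure_distr[OF meas] emeasure_pmf_of_set)
  qed
  show "(\<integral>y. g y \<partial>periodic_orbit_measure Y m q) = (\<Sum>i<m. g (q i)) / m" if "continuous_on Y g"
  proof -
    have "g \<in> borel_measurable (restrict_space borel Y)"
      using that by (rule borel_measurable_continuous_on_restrict)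
    then show ?thesis
      unfolding periodic_orbit_measure_def using ne
      by (simp add: integral_distr[OF meas] integral_pmf_of_set)
  qed
qed

text \<open>If the orbit is in \<open>A\<close> at some time, then it is in the preimage of \<open>A\<close> one step
  earlier; so the cyclic shift of time injects the visits to \<open>A\<close> into the visits to the
  preimage.\<close>

lemma invariant_periodic_orbit_measure:
  fixes Y :: "'y::t1_space set"
  assumes m: "m > 0" and q: "\<And>i. q i \<in> Y" and orb: "\<And>i. i < m \<Longrightarrow> q (Suc i) \<in> S (q i)"
    and per: "q m = q 0"
  shows "invariant_measure Y S (periodic_orbit_measure Y m q)"
proof -
  let ?\<mu> = "periodic_orbit_measure Y m q" and ?Q = "q ` {..<m}"
  note sets = sets_periodic_orbit_measure[OF m q]
  have emeasure: "emeasure ?\<mu> A = ennreal (card {i\<in>{..<m}. q i \<in> A} / m)" if "A \<in> sets ?\<mu>" for A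
    using that emeasure_periodic_orbit_measure[OF m q] by (simp add: sets)
  have fin: "F \<in> sets ?\<mu>" if "finite F" "F \<subseteq> Y" for F
    using that by (auto simp: sets sets_restrict_space intro!: image_eqI[of _ _ F] borel_closed
        finite_imp_closed)
  have Y: "Y \<in> sets ?\<mu>"
    by (auto simp: sets sets_restrict_space)
  have "emeasure ?\<mu> A \<le> emeasure (completion ?\<mu>) (set_preimage Y S A)" if A: "A \<in> sets ?\<mu>" for A
  proof -
    let ?P = "set_preimage Y S A"
    \<comment> \<open>The preimage need not be Borel. It lies in the completion because, outside the finite
       support of the measure, it is contained in a null set.\<close>
    let ?F = "?P \<inter> ?Q"
    have F: "?F \<in> sets ?\<mu>"
      by (intro fin) (auto simp: set_preimage_def)
    have N: "Y - ?Q \<in> null_sets ?\<mu>"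
    proof (rule null_setsI)
      show "Y - ?Q \<in> sets ?\<mu>"
        using Y fin[of ?Q] q by (intro sets.Diff) auto
      moreover have "{i \<in> {..<m}. q i \<in> Y - ?Q} = {}"
        by auto
      ultimately show "emeasure ?\<mu> (Y - ?Q) = 0"
        by (simp add: emeasure)
    qed
    have "?P \<in> sets (completion ?\<mu>)"
      by (rule sets_completionI[of _ ?F "?P - ?Q" "Y - ?Q"]) (use F N in \<open>auto simp: set_preimage_def\<close>)
    have "card {i\<in>{..<m}. q i \<in> A} \<le> card {i\<in>{..<m}. q i \<in> ?P}"
    proof (rule card_inj_on_le)
      let ?pred = "\<lambda>i. if i = 0 then m - 1 else i - 1"
      show "inj_on ?pred {i\<in>{..<m}. q i \<in> A}"
        by (auto simp: inj_on_def split: if_splits)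
      show "?pred ` {i\<in>{..<m}. q i \<in> A} \<subseteq> {i\<in>{..<m}. q i \<in> ?P}"
      proof (rule image_subsetI)
        fix i
        assume "i \<in> {i\<in>{..<m}. q i \<in> A}"
        then have i: "i < m" "q i \<in> A"
          by auto
        have "q i \<in> S (q (?pred i))"
          using orb[of "m - 1"] orb[of "i - 1"] i m per by (cases i) auto
        moreover have "?pred i < m"
          using i by auto
        ultimately show "?pred i \<in> {i\<in>{..<m}. q i \<in> ?P}"
          using i(2) q[of "?pred i"] unfolding set_preimage_def by blast
      qed
    qed simp
    then have "emeasure ?\<mu> A \<le> ennreal (card {i\<in>{..<m}. q i \<in> ?P} / m)"
      using m by (simp add: emeasure[OF A] divide_right_mono ennreal_leI)
    also have "{i\<in>{..<m}. q i \<in> ?P} = {i\<in>{..<m}. q i \<in> ?F}"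
      by auto
    also have "ennreal (card {i\<in>{..<m}. q i \<in> ?F} / m) = emeasure (completion ?\<mu>) ?F"
      using F by (simp add: emeasure)
    also have "\<dots> \<le> emeasure (completion ?\<mu>) ?P"
      by (rule emeasure_mono) (use \<open>?P \<in> sets (completion ?\<mu>)\<close> in auto)
    finally show ?thesis .
  qed
  then show ?thesis
    unfolding invariant_measure_def using prob_space_periodic_orbit_measure[OF m q] sets by simp
qed

text \<open>A periodic orbit of the relation lifts to the periodic orbit of its successive arrows in
  the graph system.\<close>

lemma periodic_orbit_sum_le_max_ergodic_average:
  fixes X :: "'a::metric_space set"
  assumes f: "continuous_on (gr X T) f" and m: "m > 0"
    and p: "backward_orbit (gr X T) m p" "p m = p 0"
  shows "ereal (orbit_sum f m p / m) \<le> max_ergodic_average (gr X T) (graph_system T) f"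
proof -
  \<comment> \<open>The index is reversed, as the graph system runs forward in time. The value for
     \<open>i \<ge> m\<close> is the first arrow again: this closes the orbit at \<open>i = m\<close> and keeps all
     values in the graph.\<close>
  define q where "q i = (if i < m then (p (m - i), p (m - Suc i)) else (p m, p (m - 1)))" for i
  let ?\<mu> = "periodic_orbit_measure (gr X T) m q"
  have arrow: "(p (Suc k), p k) \<in> gr X T" if "k < m" for k
    using p(1) that by (simp add: backward_orbit_def)
  have q: "q i \<in> gr X T" for i
    using arrow[of "m - Suc i"] arrow[of "m - 1"] m by (auto simp: q_def Suc_diff_Suc)
  have step: "q (Suc i) \<in> graph_system T (q i)" if "i < m" for i
  proof (cases "Suc i < m")
    case True
    then show ?thesis
      using q[of "Suc i"] that by (auto simp: q_def graph_system_def gr_def)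
  next
    case False
    then have "Suc i = m"
      using that by simp
    then show ?thesis
      using q[of m] p(2) by (auto simp: q_def graph_system_def gr_def)
  qed
  have "q m = q 0"
    using m by (simp add: q_def)
  with m q step have "invariant_measure (gr X T) (graph_system T) ?\<mu>"
    by (rule invariant_periodic_orbit_measure)
  then have "ereal (\<integral>y. f y \<partial>?\<mu>) \<le> max_ergodic_average (gr X T) (graph_system T) f"
    unfolding max_ergodic_average_def by (intro SUP_upper) simp
  moreover have "(\<Sum>i<m. f (q i)) = orbit_sum f m p"
    unfolding orbit_sum_def
    by (rule sum.reindex_bij_witness[where i = "\<lambda>k. m - Suc k" and j = "\<lambda>k. m - Suc k"])
      (auto simp: q_def Suc_diff_Suc)
  ultimately show ?thesis
    by (simp add: integral_periodic_orbit_measure[OF m q f])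
qed

section \<open>Sub-actions below the maximum ergodic average\<close>

text \<open>An infinite average is harmless: \<open>\<infinity>\<close> bounds everything, and \<open>-\<infinity>\<close> means that there is
  no invariant measure, which forces the graph to be empty. Otherwise subtract the average from
  \<open>f\<close>, which makes the sums over periodic orbits nonpositive.\<close>

theorem theorem6p2:
  fixes X :: "'a::metric_space set" and T :: "'a \<Rightarrow> 'a set"
    and \<alpha> :: real and f :: "'a \<times> 'a \<Rightarrow> real"
  assumes "compact X"
    and "set_valued_map_on X T"
    and "upper_semicontinuous_on X T"
    and "open_set_valued_on X T"
    and "expanding_on X T"
    and "compact (gr X T)"
    and "0 < \<alpha>" and "\<alpha> \<le> 1"
    and "holder_on (gr X T) max_dist \<alpha> f"
    and "gr X T \<noteq> {} \<Longrightarrow> \<exists>\<mu>. invariant_measure (gr X T) (graph_system T) \<mu>"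
  shows "\<exists>v :: 'a \<Rightarrow> real. holder_on X dist \<alpha> v \<and>
           (\<forall>(x, y)\<in>gr X T. ereal (f (x, y) + v x - v y)
              \<le> max_ergodic_average (gr X T) (graph_system T) f)"
proof (cases "max_ergodic_average (gr X T) (graph_system T) f")
  case PInf
  have "holder_on X dist \<alpha> (\<lambda>_. 0)"
    by (auto simp: holder_on_def intro: exI[of _ 1])
  with PInf show ?thesis
    by auto
next
  case MInf
  have "gr X T = {}"
  proof (rule ccontr)
    assume "gr X T \<noteq> {}"
    then obtain \<mu> where "invariant_measure (gr X T) (graph_system T) \<mu>"
      using assms(10) by blast
    then have "ereal (\<integral>y. f y \<partial>\<mu>) \<le> max_ergodic_average (gr X T) (graph_system T) f"
      unfolding max_ergodic_average_def by (intro SUP_upper) simp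
    then show False
      using MInf by simp
  qed
  moreover have "holder_on X dist \<alpha> (\<lambda>_. 0)"
    by (auto simp: holder_on_def intro: exI[of _ 1])
  ultimately show ?thesis
    by auto
next
  case (real b)
  have E: "gr X T \<subseteq> X \<times> X"
    using assms(2) by (auto simp: gr_def set_valued_map_on_def)
  have g: "holder_on (gr X T) max_dist \<alpha> (\<lambda>p. f p - b)"
    using assms(9) by (simp add: holder_on_def)
  have per: "orbit_sum (\<lambda>p. f p - b) m p \<le> 0"
    if "m > 0" "backward_orbit (gr X T) m p" "p m = p 0" for m p
  proof -
    have "orbit_sum f m p / m \<le> b"
      using periodic_orbit_sum_le_max_ergodic_average[OF hoelder_continuous_on[OF assms(9,7)] that] real
      by simp
    then show ?thesis
      using that(1) by (simp add: orbit_sum_def sum_subtractf field_simps)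
  qed
  obtain \<theta> \<delta> where "0 < \<theta>" "\<theta> < 1" "0 < \<delta>" "contracting_preimages X (gr X T) \<theta> \<delta>"
    using open_expanding_contracting_preimages assms(2,4-6) by blast
  then obtain v where "holder_on X dist \<alpha> v" "\<forall>(x, y)\<in>gr X T. f (x, y) - b + v x \<le> v y"
    using exists_hoelder_subaction[OF assms(1) E assms(6) _ _ _ _ g assms(7) per] by blast
  then show ?thesis
    unfolding real by (intro exI[of _ v]) (force simp: algebra_simps)
qed

end
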